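(* For integers $n\ge 0$ let $$G(n)=\sum_{k=0}^{n}\frac{1}{16^k}\binom{2k}{k}^2$$ (the Landau constants), let $\gamma$ be the Euler–Mascheroni constant and $c_0=\frac{1}{\pi}(\gamma+4\ln 2)$. Put $x=x(n)=(n+\tfrac34)^2$ and define $$\mathrm{MC}_0(n)=\frac{1}{\pi}\ln\left(n+\frac34\right)+c_0,\qquad \mathrm{MC}_1(n)=\frac{1}{\pi}\,\frac{\kappa_1}{x+\lambda_1},$$ $$\mathrm{MC}_2(n)=\frac{1}{\pi}\,\cfrac{\kappa_1}{x+\lambda_1+\cfrac{\kappa_2}{x+\lambda_2}},\qquad \mathrm{MC}_3(n)=\frac{1}{\pi}\,\cfrac{\kappa_1}{x+\lambda_1+\cfrac{\kappa_2}{x+\lambda_2+\cfrac{\kappa_3}{x+\lambda_3}}},$$ where $$\kappa_1=\frac{11}{192},\quad \lambda_1=\frac{1541}{7040},\quad \kappa_2=-\frac{89684299}{1040793600},\quad \lambda_2=\frac{815593360691}{631377464960},$$ $$\kappa_3=-\frac{791896453750695892475}{691850212268234428416},\quad \lambda_3=\frac{79124827964452580408836456738931}{23635681749960244849264556808320}.$$ For $k\in\{1,2,3\}$ let $E_k(n)=G(n)-\mathrm{MC}_0(n)-\mathrm{MC}_k(n)$. Then for each $k\in\{1,2,3\}$, $$\lim_{n\to\infty}n^{4k+3}\bigl(E_k(n)-E_k(n+1)\bigr)=(4k+2)C_k,\qquad \lim_{n\to\infty}n^{4k+2}E_k(n)=C_k,$$ where $$C_1=\frac{89684299}{18166579200\pi},\quad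 C_2=\frac{31675858150027835699}{5605686531912433139712\pi},\quad C_3=\frac{9662255454831353335643376823083291821}{310776980771128296411407710029663436800\pi}.$$
   Context: $\gamma=\lim_{n\to\infty}\left(\sum_{m=1}^n\frac1m-\ln n\right)$ is the Euler–Mascheroni constant. *)

theory Defs
  imports "HOL-Analysis.Analysis"
begin

definition Landau_G :: "nat \<Rightarrow> real" where
  "Landau_G n = (\<Sum>k=0..n. 1 / 16 ^ k * (real ((2 * k) choose k))\<^sup>2)"

definition c0 :: real where
  "c0 = 1 / pi * (euler_mascheroni + 4 * ln 2)"

definition xx :: "nat \<Rightarrow> real" where
  "xx n = (real n + 3 / 4)\<^sup>2"

definition kappa1 :: real where "kappa1 = 11 / 192"
definition lambda1 :: real where "lambda1 = 1541 / 7040"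
definition kappa2 :: real where "kappa2 = - (89684299 / 1040793600)"
definition lambda2 :: real where "lambda2 = 815593360691 / 631377464960"
definition kappa3 :: real where
  "kappa3 = - (791896453750695892475 / 691850212268234428416)"
definition lambda3 :: real where
  "lambda3 = 79124827964452580408836456738931 / 23635681749960244849264556808320"

definition MC0 :: "nat \<Rightarrow> real" where
  "MC0 n = 1 / pi * ln (real n + 3 / 4) + c0"

definition MC1 :: "nat \<Rightarrow> real" where
  "MC1 n = 1 / pi * (kappa1 / (xx n + lambda1))"

definition MC2 :: "nat \<Rightarrow> real" where
  "MC2 n = 1 / pi * (kappa1 / (xx n + lambda1 + kappa2 / (xx n + lambda2)))"

definition MC3 :: "nat \<Rightarrow> real" where
  "MC3 n = 1 / pi * (kappa1 / (xx n + lambda1 + kappa2 / (xx n + lambda2 + kappa3 / (xx n + lambda3))))"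

(* The last branch of MC and CC is meant for k = 3; other k are never used. *)

definition MC :: "nat \<Rightarrow> nat \<Rightarrow> real" where
  "MC k = (if k = 1 then MC1 else if k = 2 then MC2 else MC3)"

definition EE :: "nat \<Rightarrow> nat \<Rightarrow> real" where
  "EE k n = Landau_G n - MC0 n - MC k n"

definition CC :: "nat \<Rightarrow> real" where
  "CC k =
    (if k = 1 then 89684299 / (18166579200 * pi)
     else if k = 2 then 31675858150027835699 / (5605686531912433139712 * pi)
     else 9662255454831353335643376823083291821 / (310776980771128296411407710029663436800 * pi))"

end

theory Submission
  imports Defs "HOL-Real_Asymp.Real_Asymp"
begin

text \<open>
  Write $w_k = (\frac12)_k^2 / k!^2$, so that $G(n) = \sum_{k\le n} w_k$.

  The constant $c_0$ comes from Gauss's summation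
  $\sum_k w_k \, k! / (1+\varepsilon)_k = h(\varepsilon) / \varepsilon$ with
  $h(\varepsilon) = (\Gamma(1+\varepsilon) / \Gamma(\frac12+\varepsilon))^2$: subtracting
  $\sum_{k\ge1} \frac{1}{\pi k} \, k! / (1+\varepsilon)_k = \frac{1}{\pi\varepsilon}$ and letting
  $\varepsilon \to 0$ gives $1 + \sum_{k\ge1} (w_k - \frac{1}{\pi k}) = h'(0) = \frac{4 \ln 2}{\pi}$.

  For the rates, a null sequence $a$ with $n^{p+1} (a_n - a_{n+1}) \to p L$ satisfies
  $n^p a_n \to L$. Since $w_{n+1} / w_n$ is rational, this yields the expansion of $w_n$ in odd
  powers of $1 / (n + \frac14)$. In $G(n+1) - G(n) = w_{n+1}$ the points $n + \frac34$ and
  $n + \frac74$ lie symmetrically around $(n+1) + \frac14$, so the same principle yields the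
  expansion of $G(n)$ in powers of $1/x$. The continued fractions are its Pade approximants, and
  $C_k$ is the first coefficient in which they differ.
\<close>

section \<open>The summands w_k: ratio, limit and elementary bounds\<close>

definition landau_term :: "nat \<Rightarrow> real" where
  "landau_term n = (pochhammer (1 / 2) n / fact n)\<^sup>2"

lemma landau_term_0 [simp]: "landau_term 0 = 1"
  by (simp add: landau_term_def)

lemma landau_term_Suc:
  "landau_term (Suc n) = ((real n + 1 / 2) / (real n + 1))\<^sup>2 * landau_term n"
proof -
  have "pochhammer (1 / 2) (Suc n) / fact (Suc n)
      = (real n + 1 / 2) / (real n + 1) * (pochhammer (1 / 2) n / fact n)"
    by (simp add: pochhammer_Suc add.commute)
  thus ?thesis
    unfolding landau_term_def by (simp only: power_mult_distrib)
qed

lemma landau_term_pos: "landau_term n > 0"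
  using pochhammer_pos[of "1 / 2 :: real" n] by (simp add: landau_term_def)

text \<open>The duplication formula for (2k)! gives binom(2k, k) = 4^k (1/2)_k / k!, and the square
  of 4^k cancels 16^k.\<close>

lemma Landau_G_eq_sum: "Landau_G n = (\<Sum>k\<le>n. landau_term k)"
proof -
  have "1 / 16 ^ k * (real ((2 * k) choose k))\<^sup>2 = landau_term k" for k
  proof -
    have "real ((2 * k) choose k) = fact (2 * k) / (fact k * fact k)"
      by (subst binomial_fact) auto
    also have "\<dots> = 4 ^ k * (pochhammer (1 / 2) k / fact k)"
      by (subst fact_double) (simp add: power_mult)
    finally have "(real ((2 * k) choose k))\<^sup>2 = (4 ^ k)\<^sup>2 * landau_term k"
      by (simp only: landau_term_def power_mult_distrib)
    moreover have "((4::real) ^ k)\<^sup>2 = 16 ^ k"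
      by (simp flip: power_mult_distrib add: power2_eq_square)
    ultimately show ?thesis by simp
  qed
  thus ?thesis by (simp add: Landau_G_def atLeast0AtMost)
qed

text \<open>The ratio of consecutive terms is at most (n + 1) / (n + 2). This crude bound is free of
  pi and serves for domination in the series below.\<close>

lemma landau_term_le: "landau_term n \<le> 1 / (real n + 1)"
proof (induction n)
  case (Suc n)
  have "landau_term (Suc n) \<le> ((real n + 1 / 2) / (real n + 1))\<^sup>2 * (1 / (real n + 1))"
    unfolding landau_term_Suc using Suc by (intro mult_left_mono) auto
  also have "\<dots> \<le> 1 / (real (Suc n) + 1)"
    by (simp add: divide_simps power2_eq_square) (simp add: algebra_simps)
  finally show ?case .
qed simp

text \<open>For n > 0, \<open>rGamma_series (1 / 2) n\<close> is (1/2)_n (n + 1/2) / (n! sqrt n),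
  and it tends to 1 / Gamma(1/2) = 1 / sqrt pi. Its Pochhammer symbol has n + 1 factors, so the
  square carries an extra (n + 1/2)^2, which the rational prefactor removes.\<close>

lemma mult_landau_term_tendsto: "(\<lambda>n. real n * landau_term n) \<longlonglongrightarrow> 1 / pi"
proof -
  have "(\<lambda>n. (real n / (real n + 1 / 2))\<^sup>2 * (rGamma_series (1 / 2) n)\<^sup>2)
      \<longlonglongrightarrow> 1\<^sup>2 * (rGamma (1 / 2 :: real))\<^sup>2"
    by (intro tendsto_mult tendsto_power rGamma_series_LIMSEQ) real_asymp
  also have "1\<^sup>2 * (rGamma (1 / 2 :: real))\<^sup>2 = 1 / pi"
    by (simp add: rGamma_inverse_Gamma Gamma_one_half_real power_inverse inverse_eq_divide power_divide)
  finally show ?thesis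
  proof (rule Lim_transform_eventually)
    show "\<forall>\<^sub>F n in sequentially. (real n / (real n + 1 / 2))\<^sup>2 * (rGamma_series (1 / 2) n)\<^sup>2
        = real n * landau_term n"
      using eventually_gt_at_top[of 0]
    proof eventually_elim
      case (elim n)
      have "(exp (ln (real n) / 2))\<^sup>2 = real n"
        using elim by (simp add: power2_eq_square flip: exp_add)
      thus ?case using elim
        by (simp add: rGamma_series_def landau_term_def pochhammer_Suc power_divide
              power_mult_distrib divide_simps) (simp add: algebra_simps power2_eq_square)
    qed
  qed
qed

text \<open>The sequence (n + 1/2) w_n decreases to 1/pi, while n w_n increases to the same limit.
  Together the two facts locate w_n up to O(1/n^2).\<close>

lemma landau_term_lower: "1 / pi \<le> (real n + 1 / 2) * landau_term n"
proof -
  have dec: "decseq (\<lambda>n. (real n + 1 / 2) * landau_term n)"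
  proof (rule decseq_SucI)
    fix n
    have "(real (Suc n) + 1 / 2) * ((real n + 1 / 2) / (real n + 1))\<^sup>2 \<le> real n + 1 / 2"
      by (simp add: divide_simps power2_eq_square) (simp add: algebra_simps)
    from mult_right_mono[OF this, of "landau_term n"] landau_term_pos[of n]
    show "(real (Suc n) + 1 / 2) * landau_term (Suc n) \<le> (real n + 1 / 2) * landau_term n"
      by (simp add: landau_term_Suc mult_ac)
  qed
  have "(\<lambda>n. real n * landau_term n + 1 / 2 * landau_term n) \<longlonglongrightarrow> 1 / pi + 1 / 2 * 0"
  proof (intro tendsto_intros mult_landau_term_tendsto)
    show "landau_term \<longlonglongrightarrow> 0"
      by (rule tendsto_sandwich[of "\<lambda>_. 0" _ _ "\<lambda>n. 1 / (real n + 1)"])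
         (use landau_term_le landau_term_pos in \<open>auto intro!: always_eventually less_imp_le\<close>, real_asymp)
  qed
  hence "(\<lambda>n. (real n + 1 / 2) * landau_term n) \<longlonglongrightarrow> 1 / pi"
    by (simp add: algebra_simps)
  from decseq_ge[OF dec this] show ?thesis .
qed

lemma landau_term_upper: "real n * landau_term n \<le> 1 / pi"
proof -
  have "incseq (\<lambda>n. real n * landau_term n)"
  proof (rule incseq_SucI)
    fix n
    have "real n \<le> (real (Suc n)) * ((real n + 1 / 2) / (real n + 1))\<^sup>2"
      by (simp add: divide_simps power2_eq_square) (simp add: algebra_simps)
    from mult_right_mono[OF this, of "landau_term n"] landau_term_pos[of n]
    show "real n * landau_term n \<le> real (Suc n) * landau_term (Suc n)"
      by (simp add: landau_term_Suc mult_ac)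
  qed
  from incseq_le[OF this mult_landau_term_tendsto] show ?thesis .
qed

section \<open>Gauss's summation at the argument 1\<close>

text \<open>The quotient equals e times \<open>Gamma_series e k\<close> times k^(-e). The Gamma
  series converges to Gamma(e), and the power decays.\<close>

lemma fact_over_pochhammer_tendsto_0:
  fixes e :: real
  assumes "e > 0"
  shows "(\<lambda>k. fact k / pochhammer (1 + e) k) \<longlonglongrightarrow> 0"
proof -
  have "(\<lambda>k. e * Gamma_series e k * (exp (- (e * ln (real k))))) \<longlonglongrightarrow> e * Gamma e * 0"
    by (intro tendsto_intros Gamma_series_LIMSEQ) (use assms in real_asymp)
  moreover have "e * Gamma_series e k * (exp (- (e * ln (real k)))) = fact k / pochhammer (1 + e) k" for k
    using assms by (simp add: Gamma_series_def pochhammer_rec exp_minus add.commute field_simps)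
  ultimately show ?thesis by simp
qed

text \<open>The series telescopes: consecutive differences of k! / (1+e)_k are e times its terms.
  With j = k + 1 the term reads (1/j) j! / (1+e)_j, the comparison series for the Gauss sum.\<close>

lemma fact_over_pochhammer_sums:
  fixes e :: real
  assumes "e > 0"
  shows "(\<lambda>k. fact k / pochhammer (1 + e) (Suc k)) sums (1 / e)"
proof -
  have *: "fact k / pochhammer (1 + e) k - fact (Suc k) / pochhammer (1 + e) (Suc k)
        = e * (fact k / pochhammer (1 + e) (Suc k))" for k
  proof -
    have "pochhammer (1 + e) k > 0" "1 + e + real k > 0"
      using assms by (auto intro: pochhammer_pos)
    thus ?thesis by (simp add: pochhammer_Suc divide_simps) (simp add: algebra_simps)
  qed
  from sums_divide[OF telescope_sums'[OF fact_over_pochhammer_tendsto_0[OF assms]], of e]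
  show ?thesis using assms by (simp add: * del: fact_Suc pochhammer_Suc)
qed

text \<open>This is (1/2)_k^2 / ((c)_k k!), the term of the hypergeometric series 2F1(1/2, 1/2; c;
  1).\<close>

definition gauss_term :: "real \<Rightarrow> nat \<Rightarrow> real" where
  "gauss_term c k = landau_term k * fact k / pochhammer c k"

lemma gauss_term_nonneg: "c > 0 \<Longrightarrow> gauss_term c k \<ge> 0"
  unfolding gauss_term_def using landau_term_pos[of k]
  by (intro divide_nonneg_pos pochhammer_pos) auto

lemma summable_gauss_term:
  assumes "c > 1"
  shows "summable (gauss_term c)"
proof -
  define e where "e = c - 1"
  have e: "e > 0" "c = 1 + e" using assms by (auto simp: e_def)
  have "summable (\<lambda>k. gauss_term c (Suc k))"
  proof (rule summable_comparison_test')
    show "summable (\<lambda>k. fact k / pochhammer (1 + e) (Suc k))"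
      using fact_over_pochhammer_sums[OF e(1)] by (rule sums_summable)
    fix k :: nat
    \<comment> \<open>Since (k + 1)! = (k + 1) k!, the spare factor k + 1 is absorbed by the bound
      on w_{k+1}, which leaves the telescoping series as majorant.\<close>
    have "real (Suc k) * landau_term (Suc k) \<le> 1"
      using landau_term_le[of "Suc k"] landau_term_pos[of "Suc k"] by (simp add: field_simps)
    hence "real (Suc k) * landau_term (Suc k) * (fact k / pochhammer c (Suc k))
        \<le> 1 * (fact k / pochhammer c (Suc k))"
      using assms by (intro mult_right_mono) (auto intro!: divide_nonneg_pos pochhammer_pos simp del: pochhammer_Suc)
    thus "norm (gauss_term c (Suc k)) \<le> fact k / pochhammer (1 + e) (Suc k)"
      using gauss_term_nonneg[of c "Suc k"] assms e
      by (simp add: gauss_term_def mult_ac)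
  qed
  thus ?thesis by (subst (asm) summable_Suc_iff)
qed

definition gauss_sum :: "real \<Rightarrow> real" where
  "gauss_sum c = (\<Sum>k. gauss_term c k)"

text \<open>A certificate in Zeilberger's style for the contiguous relation in c. The telescoping
  quantity c k \<open>gauss_term c k\<close> vanishes at k = 0, so that only its limit at infinity
  matters for the sum.\<close>

lemma gauss_term_telescope:
  assumes "c > 0"
  shows "c * (c - 1) * gauss_term c k - (c - 1 / 2)\<^sup>2 * gauss_term (c + 1) k
      = c * real k * gauss_term c k - c * real (Suc k) * gauss_term c (Suc k)"
proof -
  define P where "P = pochhammer c k"
  have P: "P > 0" using assms by (auto simp: P_def intro: pochhammer_pos)
  have 1: "gauss_term (c + 1) k = gauss_term c k * c / (c + k)"
  proof -
    have "c * pochhammer (c + 1) k = (c + k) * P"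
      unfolding P_def by (metis add.commute pochhammer_rec pochhammer_rec')
    hence "pochhammer (c + 1) k = (c + k) * P / c" using assms by (simp add: field_simps)
    thus ?thesis unfolding gauss_term_def P_def[symmetric] using assms P by simp
  qed
  have 2: "gauss_term c (Suc k) = gauss_term c k * (k + 1 / 2)\<^sup>2 / ((k + 1) * (c + k))"
  proof -
    have "c + k > 0" using assms by simp
    thus ?thesis unfolding gauss_term_def pochhammer_Suc P_def[symmetric] landau_term_Suc
      using P by (simp add: divide_simps power2_eq_square) (simp add: algebra_simps)
  qed
  have "c + k > 0" using assms by simp
  thus ?thesis unfolding 1 2
    by (simp add: divide_simps power2_eq_square) (simp add: algebra_simps)
qed

lemma gauss_sum_contiguous:
  assumes "c > 1"
  shows "c * (c - 1) * gauss_sum c = (c - 1 / 2)\<^sup>2 * gauss_sum (c + 1)"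
proof -
  have "(\<lambda>k. real k * gauss_term c k) \<longlonglongrightarrow> 0"
  proof (rule tendsto_sandwich[of "\<lambda>_. 0" _ _ "\<lambda>k. fact k / pochhammer (1 + (c - 1)) k"])
    show "\<forall>\<^sub>F k in sequentially. real k * gauss_term c k \<le> fact k / pochhammer (1 + (c - 1)) k"
    proof (intro always_eventually allI)
      fix k :: nat
      have "real k * landau_term k \<le> 1"
        using landau_term_le[of k] landau_term_pos[of k] by (simp add: field_simps)
      hence "real k * landau_term k * (fact k / pochhammer c k) \<le> 1 * (fact k / pochhammer c k)"
        using assms by (intro mult_right_mono) (auto intro!: divide_nonneg_pos pochhammer_pos)
      thus "real k * gauss_term c k \<le> fact k / pochhammer (1 + (c - 1)) k"
        by (simp add: gauss_term_def mult_ac)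
    qed
  next
    show "\<forall>\<^sub>F k in sequentially. 0 \<le> real k * gauss_term c k"
      using assms by (intro always_eventually allI mult_nonneg_nonneg gauss_term_nonneg) auto
  qed (use assms fact_over_pochhammer_tendsto_0[of "c - 1"] in auto)
  hence "(\<lambda>k. c * (real k * gauss_term c k)) \<longlonglongrightarrow> c * 0"
    by (intro tendsto_intros)
  hence "(\<lambda>k. c * real k * gauss_term c k) \<longlonglongrightarrow> 0" by (simp add: mult_ac)
  from telescope_sums'[OF this]
  have "(\<lambda>k. c * (c - 1) * gauss_term c k - (c - 1 / 2)\<^sup>2 * gauss_term (c + 1) k) sums 0"
    using assms by (subst gauss_term_telescope) auto
  moreover have "(\<lambda>k. c * (c - 1) * gauss_term c k - (c - 1 / 2)\<^sup>2 * gauss_term (c + 1) k) sums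
      (c * (c - 1) * gauss_sum c - (c - 1 / 2)\<^sup>2 * gauss_sum (c + 1))"
    unfolding gauss_sum_def using assms
    by (intro sums_diff sums_mult summable_sums summable_gauss_term) auto
  ultimately show ?thesis using sums_unique2 by fastforce
qed

lemma gauss_sum_iterate:
  assumes "c > 1"
  shows "pochhammer c m * pochhammer (c - 1) m * gauss_sum c
      = (pochhammer (c - 1 / 2) m)\<^sup>2 * gauss_sum (c + real m)"
proof (induction m)
  case (Suc m)
  have "pochhammer c (Suc m) * pochhammer (c - 1) (Suc m) * gauss_sum c
     = (c + m) * (c + m - 1) * (pochhammer c m * pochhammer (c - 1) m * gauss_sum c)"
    by (simp add: pochhammer_Suc algebra_simps)
  also have "\<dots> = (pochhammer (c - 1 / 2) m)\<^sup>2 * ((c + m) * (c + m - 1) * gauss_sum (c + m))"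
    unfolding Suc.IH by simp
  also have "(c + m) * (c + m - 1) * gauss_sum (c + m) = (c + m - 1 / 2)\<^sup>2 * gauss_sum (c + m + 1)"
    using assms by (intro gauss_sum_contiguous) auto
  finally show ?case
    by (simp only: pochhammer_Suc power_mult_distrib) (simp add: algebra_simps)
qed simp

text \<open>Only the term k = 0 survives. In every later term the first factor c of (c)_{k+1}
  becomes c + m and the other factors do not decrease, so the tail is at most c / (c + m) times the
  tail at c.\<close>

lemma gauss_sum_tendsto_1:
  assumes "c > 1"
  shows "(\<lambda>m. gauss_sum (c + real m)) \<longlonglongrightarrow> 1"
proof -
  define K where "K = (\<Sum>k. gauss_term c (Suc k))"
  have bound: "gauss_term (c + real m) (Suc k) \<le> c / (c + real m) * gauss_term c (Suc k)" for m k
  proof -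
    have "pochhammer (c + 1) k \<le> pochhammer (c + real m + 1) k"
      unfolding pochhammer_prod using assms by (intro prod_mono) auto
    moreover have "pochhammer (c + 1) k > 0" using assms by (intro pochhammer_pos) auto
    ultimately have "1 / pochhammer (c + real m + 1) k \<le> 1 / pochhammer (c + 1) k"
      by (intro divide_left_mono) auto
    hence "(landau_term (Suc k) * fact (Suc k) / (c + real m)) * (1 / pochhammer (c + real m + 1) k)
      \<le> (landau_term (Suc k) * fact (Suc k) / (c + real m)) * (1 / pochhammer (c + 1) k)"
      using assms landau_term_pos[of "Suc k"]
      by (intro mult_left_mono divide_nonneg_pos mult_nonneg_nonneg) auto
    thus ?thesis using assms by (simp add: gauss_term_def pochhammer_rec mult_ac)
  qed
  have split: "gauss_sum c' = 1 + (\<Sum>k. gauss_term c' (Suc k))" if "c' > 1" for c'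
    unfolding gauss_sum_def using suminf_split_head[OF summable_gauss_term[OF that]]
    by (simp add: gauss_term_def)
  have sm: "summable (\<lambda>k. gauss_term c' (Suc k))" if "c' > 1" for c'
    using summable_gauss_term[OF that] by (subst summable_Suc_iff)
  show ?thesis
  proof (rule tendsto_sandwich[of "\<lambda>_. 1" _ _ "\<lambda>m. 1 + c / (c + real m) * K"])
    show "\<forall>\<^sub>F m in sequentially. 1 \<le> gauss_sum (c + real m)"
      using assms by (intro always_eventually allI)
        (auto simp: split intro!: suminf_nonneg sm gauss_term_nonneg)
    show "\<forall>\<^sub>F m in sequentially. gauss_sum (c + real m) \<le> 1 + c / (c + real m) * K"
    proof (intro always_eventually allI)
      fix m
      have "(\<Sum>k. gauss_term (c + real m) (Suc k)) \<le> (\<Sum>k. c / (c + real m) * gauss_term c (Suc k))"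
        using assms by (intro suminf_le bound summable_mult sm) auto
      also have "\<dots> = c / (c + real m) * K"
        unfolding K_def using assms by (intro suminf_mult sm) auto
      finally show "gauss_sum (c + real m) \<le> 1 + c / (c + real m) * K"
        using assms by (simp add: split)
    qed
    show "(\<lambda>m. 1 + c / (c + real m) * K) \<longlonglongrightarrow> 1" by real_asymp
  qed auto
qed

text \<open>Shifting c by m + 1 and letting m grow sends the shifted sum to 1. The accumulated
  Pochhammer symbols, suitably normalised, become reciprocal Gamma values. The shift is
  \<open>Suc m\<close> because \<open>rGamma_series\<close> at m uses m + 1 factors.\<close>

lemma gauss_sum_eq_Gamma:
  assumes "e > 0"
  shows "gauss_sum (1 + e) = (Gamma (1 + e) / Gamma (1 / 2 + e))\<^sup>2 / e"
proof -
  have "(\<lambda>m. rGamma_series (1 + e) m * rGamma_series e m * gauss_sum (1 + e))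
      \<longlonglongrightarrow> rGamma (1 + e) * rGamma e * gauss_sum (1 + e)"
    by (intro tendsto_intros rGamma_series_LIMSEQ)
  moreover have "(\<lambda>m. (rGamma_series (1 / 2 + e) m)\<^sup>2 * gauss_sum (1 + e + real (Suc m)))
      \<longlonglongrightarrow> (rGamma (1 / 2 + e))\<^sup>2 * 1"
    using assms
    by (intro tendsto_intros rGamma_series_LIMSEQ LIMSEQ_Suc gauss_sum_tendsto_1) auto
  moreover have "rGamma_series (1 + e) m * rGamma_series e m * gauss_sum (1 + e)
      = (rGamma_series (1 / 2 + e) m)\<^sup>2 * gauss_sum (1 + e + real (Suc m))" for m
  proof -
    \<comment> \<open>Both sides carry the same normalisation, since (1 + e) + e = 2 (1/2 +
      e).\<close>
    define X where "X = (fact m)\<^sup>2 * exp ((1 + 2 * e) * ln (real m))"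
    have X: "fact m * exp ((1 + e) * ln (real m)) * (fact m * exp (e * ln (real m))) = X"
      "(fact m * exp ((1 / 2 + e) * ln (real m)))\<^sup>2 = X"
      unfolding X_def by (simp_all add: power2_eq_square algebra_simps flip: exp_add)
    have "rGamma_series (1 + e) m * rGamma_series e m * gauss_sum (1 + e)
      = pochhammer (1 + e) (Suc m) * pochhammer e (Suc m) * gauss_sum (1 + e) / X"
      unfolding rGamma_series_def X(1)[symmetric] by simp
    also have "pochhammer (1 + e) (Suc m) * pochhammer e (Suc m) * gauss_sum (1 + e)
      = (pochhammer (1 / 2 + e) (Suc m))\<^sup>2 * gauss_sum (1 + e + real (Suc m))"
      using gauss_sum_iterate[of "1 + e" "Suc m"] assms by (simp add: algebra_simps)
    also have "\<dots> / X = (rGamma_series (1 / 2 + e) m)\<^sup>2 * gauss_sum (1 + e + real (Suc m))"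
      unfolding rGamma_series_def X(2)[symmetric] by (simp add: power_divide)
    finally show ?thesis .
  qed
  ultimately have eq: "rGamma (1 + e) * rGamma e * gauss_sum (1 + e) = (rGamma (1 / 2 + e))\<^sup>2"
    using LIMSEQ_unique by fastforce
  have pos: "Gamma (1 + e) > 0" "Gamma e > 0" "Gamma (1 / 2 + e) > 0"
    using assms by auto
  have "Gamma (1 + e) = e * Gamma e"
    using Gamma_plus1[of e] assms nonpos_Ints_nonpos[of e] by (force simp: add.commute)
  with eq pos assms show ?thesis
    by (simp add: rGamma_inverse_Gamma field_simps power2_eq_square)
qed

section \<open>The constant term of the expansion\<close>

text \<open>With n = k + 1, the two monotone bounds give 0 <= 1/(pi n) - w_n <= w_n / (2n), and w_n
  <= 1/n.\<close>

lemma landau_term_minus_bound: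
  "\<bar>landau_term (Suc k) - 1 / (pi * (real k + 1))\<bar> \<le> 1 / (real k + 1)\<^sup>2"
proof -
  have "landau_term (Suc k) \<le> 1 / (real k + 1)"
    using landau_term_le[of "Suc k"] by (rule order_trans) (auto simp: field_simps)
  moreover have "landau_term (Suc k) \<le> 1 / pi / (real k + 1)"
    using landau_term_upper[of "Suc k"] by (subst pos_le_divide_eq) (auto simp: mult.commute add.commute)
  moreover have "1 / pi / (real k + 1) \<le> landau_term (Suc k) + landau_term (Suc k) / (2 * (real k + 1))"
  proof -
    have "1 / pi / (real k + 1) \<le> (real (Suc k) + 1 / 2) * landau_term (Suc k) / (real k + 1)"
      by (intro divide_right_mono landau_term_lower) auto
    also have "\<dots> = landau_term (Suc k) + landau_term (Suc k) / (2 * (real k + 1))"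
      by (simp add: divide_simps) (simp add: algebra_simps)
    finally show ?thesis .
  qed
  moreover have "landau_term (Suc k) / (2 * (real k + 1)) \<le> (1 / (real k + 1)) / (1 * (real k + 1))"
    using landau_term_pos[of "Suc k"] calculation(1) by (intro frac_le) auto
  ultimately show ?thesis
    by (simp add: power2_eq_square)
qed

lemma summable_inverse_Suc_squares: "summable (\<lambda>k. 1 / (real k + 1)\<^sup>2)"
proof -
  have "summable (\<lambda>k. inverse (real k ^ 2))"
    by (rule inverse_power_summable) simp
  hence "summable (\<lambda>k. inverse (real (Suc k) ^ 2))"
    by (subst summable_Suc_iff)
  thus ?thesis by (simp add: inverse_eq_divide add.commute)
qed

text \<open>The series starts at index 1, which accounts for the -1. The factor 1/(k + 1) cancels
  against (k + 1)!, so the subtracted part is the telescoping series with sum 1/e.\<close>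

lemma gauss_sum_minus_pole:
  assumes "e > 0"
  shows "(\<Sum>k. (landau_term (Suc k) - 1 / (pi * (real k + 1))) * (fact (Suc k) / pochhammer (1 + e) (Suc k)))
      = gauss_sum (1 + e) - 1 - 1 / (pi * e)"
proof -
  have "gauss_term (1 + e) sums gauss_sum (1 + e)"
    unfolding gauss_sum_def using assms by (intro summable_sums summable_gauss_term) auto
  hence "(\<lambda>k. gauss_term (1 + e) (Suc k)) sums (gauss_sum (1 + e) - 1)"
    by (subst sums_Suc_iff) (simp add: gauss_term_def)
  from sums_diff[OF this sums_mult[OF fact_over_pochhammer_sums[OF assms], of "1 / pi"]]
  have "(\<lambda>k. gauss_term (1 + e) (Suc k) - 1 / pi * (fact k / pochhammer (1 + e) (Suc k)))
      sums (gauss_sum (1 + e) - 1 - 1 / (pi * e))"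
    by simp
  moreover have "gauss_term (1 + e) (Suc k) - 1 / pi * (fact k / pochhammer (1 + e) (Suc k))
     = (landau_term (Suc k) - 1 / (pi * (real k + 1))) * (fact (Suc k) / pochhammer (1 + e) (Suc k))" for k
    by (simp add: gauss_term_def left_diff_distrib diff_divide_distrib add.commute)
  ultimately show ?thesis using sums_unique by fastforce
qed

text \<open>The logarithmic derivative at 0 is 2 (psi(1) - psi(1/2)) = 4 ln 2, and the value at 0 is
  1/pi.\<close>

lemma Gamma_quotient_square_deriv:
  "((\<lambda>e. (Gamma (1 + e) / Gamma (1 / 2 + e))\<^sup>2) has_real_derivative 4 * ln 2 / pi) (at 0)"
proof -
  have "1 / 2 \<notin> (\<int>\<^sub>\<le>\<^sub>0 :: real set)" by (auto elim!: nonpos_Ints_cases)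
  thus ?thesis
    by (auto intro!: derivative_eq_intros elim!: nonpos_Ints_cases
          simp: Digamma_one_half Gamma_one_half_real power2_eq_square)
       (simp add: field_simps)
qed

text \<open>Tannery's theorem lets e tend to 0 from the right termwise: the weights (k+1)! /
  (1+e)_{k+1} lie in [0, 1] and tend to 1, so the differences, bounded by 1/(k+1)^2,
  dominate.\<close>

lemma suminf_landau_term_minus:
  "1 + (\<Sum>k. landau_term (Suc k) - 1 / (pi * (real k + 1))) = 4 * ln 2 / pi"
proof -
  let ?d = "\<lambda>k. landau_term (Suc k) - 1 / (pi * (real k + 1))"
  let ?h = "\<lambda>e. (Gamma (1 + e) / Gamma (1 / 2 + e))\<^sup>2 :: real"
  let ?S = "\<lambda>e. \<Sum>k. ?d k * (fact (Suc k) / pochhammer (1 + e) (Suc k))"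
  have lim1: "(?S \<longlongrightarrow> (\<Sum>k. ?d k * (fact (Suc k) / pochhammer (1 + 0) (Suc k)))) (at_right 0)"
  proof (rule tannerys_theorem[THEN conjunct2, THEN conjunct2])
    fix k
    have "pochhammer (1 + 0 :: real) (Suc k) \<noteq> 0"
      using pochhammer_pos[of "1 :: real" "Suc k"] by simp
    moreover have "((\<lambda>e. pochhammer (1 + e) (Suc k)) \<longlongrightarrow> pochhammer (1 + 0 :: real) (Suc k)) (at_right 0)"
      unfolding pochhammer_prod by (intro tendsto_intros)
    ultimately show "((\<lambda>e. ?d k * (fact (Suc k) / pochhammer (1 + e) (Suc k)))
        \<longlongrightarrow> ?d k * (fact (Suc k) / pochhammer (1 + 0) (Suc k))) (at_right 0)"
      by (intro tendsto_intros)
  next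
    have "norm (?d k * (fact (Suc k) / pochhammer (1 + e) (Suc k))) \<le> 1 / (real k + 1)\<^sup>2"
      if "e > 0" for k and e :: real
    proof -
      have "pochhammer 1 (Suc k) \<le> pochhammer (1 + e) (Suc k)"
        unfolding pochhammer_prod using that by (intro prod_mono) auto
      hence "fact (Suc k) \<le> pochhammer (1 + e) (Suc k)"
        by (simp only: pochhammer_fact[symmetric])
      moreover have "pochhammer (1 + e) (Suc k) > 0" using that by (intro pochhammer_pos) auto
      ultimately have "\<bar>fact (Suc k) / pochhammer (1 + e) (Suc k)\<bar> \<le> 1"
        by (simp add: abs_div_pos del: fact_Suc pochhammer_Suc)
      from mult_mono[OF landau_term_minus_bound this] show ?thesis
        by (simp only: real_norm_def abs_mult) simp
    qed
    thus "\<forall>\<^sub>F (k, e) in sequentially \<times>\<^sub>F at_right 0.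
        norm (?d k * (fact (Suc k) / pochhammer (1 + e) (Suc k))) \<le> 1 / (real k + 1)\<^sup>2"
      by (intro eventually_mono[OF eventually_prodI[OF always_eventually eventually_at_right_less]])
         (auto simp del: fact_Suc)
  qed (use summable_inverse_Suc_squares in auto)
  have "((\<lambda>e. (?h (0 + e) - ?h 0) / e) \<longlongrightarrow> 4 * ln 2 / pi) (at 0)"
    using Gamma_quotient_square_deriv by (simp only: DERIV_def)
  hence "((\<lambda>e. (?h (0 + e) - ?h 0) / e - 1) \<longlongrightarrow> 4 * ln 2 / pi - 1) (at_right 0)"
    by (intro tendsto_diff tendsto_const) (rule tendsto_within_subset, auto)
  hence lim2: "(?S \<longlongrightarrow> 4 * ln 2 / pi - 1) (at_right 0)"
  proof (rule Lim_transform_eventually)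
    show "\<forall>\<^sub>F e in at_right 0. (?h (0 + e) - ?h 0) / e - 1 = ?S e"
      using eventually_at_right_less[of 0]
    proof eventually_elim
      case (elim e)
      \<comment> \<open>This value makes the pole 1/(pi e) turn h(e)/e into the difference quotient
        of h at 0.\<close>
      have "?h 0 = 1 / pi"
        by (simp add: Gamma_one_half_real power_divide)
      thus ?case unfolding gauss_sum_minus_pole[OF elim] gauss_sum_eq_Gamma[OF elim]
        by (simp add: diff_divide_distrib)
    qed
  qed
  have "(\<Sum>k. ?d k * (fact (Suc k) / pochhammer (1 + 0) (Suc k))) = 4 * ln 2 / pi - 1"
    by (rule tendsto_unique[OF _ lim1 lim2]) simp
  moreover have "fact (Suc k) / pochhammer (1 + 0 :: real) (Suc k) = 1" for k
    by (simp only: add_0_right pochhammer_fact[symmetric]) simp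
  ultimately show ?thesis by (simp del: fact_Suc pochhammer_Suc)
qed

lemma Landau_G_minus_MC0_tendsto_0: "(\<lambda>n. Landau_G n - MC0 n) \<longlonglongrightarrow> 0"
proof -
  let ?d = "\<lambda>k. landau_term (Suc k) - 1 / (pi * (real k + 1))"
  have "summable ?d"
    by (rule summable_comparison_test'[OF summable_inverse_Suc_squares])
       (use landau_term_minus_bound in auto)
  hence "(\<lambda>n. \<Sum>k<n. ?d k) \<longlonglongrightarrow> (\<Sum>k. ?d k)"
    by (rule summable_LIMSEQ)
  moreover have "(\<lambda>n. ln (real n) - ln (real n + 3 / 4)) \<longlonglongrightarrow> 0" by real_asymp
  \<comment> \<open>The sum of the 1/(pi k) is split off as \<open>harm n\<close>, whose excess over
    ln n supplies gamma; the shift from ln n to ln(n + 3/4) costs nothing in the limit.\<close>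
  ultimately have "(\<lambda>n. 1 + (\<Sum>k<n. ?d k) + 1 / pi * (harm n - ln (real n))
        + 1 / pi * (ln (real n) - ln (real n + 3 / 4)) - c0)
      \<longlonglongrightarrow> 1 + (\<Sum>k. ?d k) + 1 / pi * euler_mascheroni + 1 / pi * 0 - c0"
    by (intro tendsto_add tendsto_diff tendsto_mult tendsto_const
          euler_mascheroni_LIMSEQ[unfolded of_nat_id])
  also have "1 + (\<Sum>k. ?d k) + 1 / pi * euler_mascheroni + 1 / pi * 0 - c0 = 0"
    unfolding suminf_landau_term_minus c0_def by (simp add: field_simps)
  also have "(\<lambda>n. 1 + (\<Sum>k<n. ?d k) + 1 / pi * (harm n - ln (real n))
        + 1 / pi * (ln (real n) - ln (real n + 3 / 4)) - c0) = (\<lambda>n. Landau_G n - MC0 n)"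
  proof
    fix n
    have "(\<Sum>k\<le>n. landau_term k) = 1 + (\<Sum>k<n. landau_term (Suc k))"
      unfolding lessThan_Suc_atMost[symmetric] by (simp add: sum.lessThan_Suc_shift del: sum.lessThan_Suc)
    moreover have "harm n = (\<Sum>k<n. 1 / (real k + 1))"
      by (induction n) (auto simp: harm_Suc harm_expand inverse_eq_divide add.commute)
    hence "1 / pi * harm n = (\<Sum>k<n. 1 / (pi * (real k + 1)))"
      by (simp add: sum_distrib_left)
    ultimately show "1 + (\<Sum>k<n. ?d k) + 1 / pi * (harm n - ln (real n))
        + 1 / pi * (ln (real n) - ln (real n + 3 / 4)) - c0 = Landau_G n - MC0 n"
      unfolding Landau_G_eq_sum MC0_def
      by (simp add: sum_subtractf right_diff_distrib)
  qed
  finally show ?thesis .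
qed

section \<open>From limits of differences to limits of sequences\<close>

text \<open>The 0/0 case of the Stolz-Cesaro theorem. From some index on, both (e/2) b - (a - L b)
  and (e/2) b + (a - L b) are nonincreasing; as they tend to 0 they are nonnegative, which bounds |a
  - L b| by (e/2) b.\<close>

lemma stolz_cesaro_0:
  fixes a b :: "nat \<Rightarrow> real"
  assumes a: "a \<longlonglongrightarrow> 0" and b: "b \<longlonglongrightarrow> 0"
    and dec: "\<forall>\<^sub>F n in sequentially. b (Suc n) < b n"
    and lim: "(\<lambda>n. (a n - a (Suc n)) / (b n - b (Suc n))) \<longlonglongrightarrow> L"
  shows "(\<lambda>n. a n / b n) \<longlonglongrightarrow> L"
proof (rule tendstoI)
  fix e :: real assume e: "e > 0"
  have nonneg: "f n \<ge> 0"
    if "\<And>m. m \<ge> n \<Longrightarrow> f (Suc m) \<le> f m" "f \<longlonglongrightarrow> 0" for f :: "nat \<Rightarrow> real" and n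
  proof -
    have "decseq (\<lambda>m. f (m + n))" by (intro decseq_SucI) (simp add: that)
    from decseq_ge[OF this LIMSEQ_ignore_initial_segment[OF that(2)], of 0] show ?thesis by simp
  qed
  have "\<forall>\<^sub>F n in sequentially. dist ((a n - a (Suc n)) / (b n - b (Suc n))) L < e / 2"
    using tendstoD[OF lim, of "e / 2"] e by simp
  with dec have "\<forall>\<^sub>F n in sequentially. b (Suc n) < b n \<and>
      \<bar>(a n - a (Suc n)) / (b n - b (Suc n)) - L\<bar> < e / 2"
    by eventually_elim (auto simp: dist_real_def)
  then obtain N where N: "\<And>n. n \<ge> N \<Longrightarrow> b (Suc n) < b n"
    "\<And>n. n \<ge> N \<Longrightarrow> \<bar>(a n - a (Suc n)) / (b n - b (Suc n)) - L\<bar> < e / 2"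
    by (auto simp: eventually_sequentially)
  have step: "\<bar>(a m - L * b m) - (a (Suc m) - L * b (Suc m))\<bar> \<le> e / 2 * (b m - b (Suc m))"
    if "m \<ge> N" for m
  proof -
    have "(a m - L * b m) - (a (Suc m) - L * b (Suc m))
        = ((a m - a (Suc m)) / (b m - b (Suc m)) - L) * (b m - b (Suc m))"
      using N(1)[OF that] by (simp add: field_simps)
    also have "\<bar>\<dots>\<bar> \<le> e / 2 * (b m - b (Suc m))"
      unfolding abs_mult using N[OF that] e by (intro mult_mono) auto
    finally show ?thesis .
  qed
  have "dist (a n / b n) L < e" if n: "n \<ge> N" for n
  proof -
    have "b (Suc n) \<ge> 0" using N(1) n by (intro nonneg b less_imp_le) auto
    with N(1)[OF n] have bpos: "b n > 0" by simp
    have lims: "(\<lambda>m. e / 2 * b m - (a m - L * b m)) \<longlonglongrightarrow> 0"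
               "(\<lambda>m. e / 2 * b m + (a m - L * b m)) \<longlonglongrightarrow> 0"
      by (auto intro!: tendsto_eq_intros a b)
    have step': "e / 2 * b (Suc m) - (a (Suc m) - L * b (Suc m)) \<le> e / 2 * b m - (a m - L * b m)"
      "e / 2 * b (Suc m) + (a (Suc m) - L * b (Suc m)) \<le> e / 2 * b m + (a m - L * b m)" if "m \<ge> n" for m
      using step[of m] n that unfolding right_diff_distrib abs_le_iff by linarith+
    have "e / 2 * b n - (a n - L * b n) \<ge> 0"
      by (rule nonneg[OF step'(1) lims(1)])
    moreover have "e / 2 * b n + (a n - L * b n) \<ge> 0"
      by (rule nonneg[OF step'(2) lims(2)])
    ultimately have "\<bar>a n - L * b n\<bar> \<le> e / 2 * b n" by linarith
    moreover have "a n / b n - L = (a n - L * b n) / b n"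
      using bpos by (simp add: field_simps)
    ultimately have "\<bar>a n / b n - L\<bar> \<le> e / 2"
      using bpos by (simp add: abs_div_pos[symmetric] pos_divide_le_eq)
    thus ?thesis using e by (simp add: dist_real_def)
  qed
  thus "\<forall>\<^sub>F n in sequentially. dist (a n / b n) L < e"
    by (auto simp: eventually_sequentially)
qed

text \<open>With v = 1/(n + s), the bracket is (n + s)^(-p) times the increment of -(1 + v)^(-p)
  from 0, and that function has derivative p at 0.\<close>

lemma inverse_power_diff_tendsto:
  fixes p :: nat and s :: real
  shows "(\<lambda>n. real n ^ (p + 1) * (1 / (real n + s) ^ p - 1 / (real (Suc n) + s) ^ p)) \<longlonglongrightarrow> p"
proof -
  have "((\<lambda>v::real. - ((1 / (1 + v)) ^ p)) has_real_derivative p) (at 0)"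
    by (auto intro!: derivative_eq_intros)
  hence "((\<lambda>v. (- ((1 / (1 + (0 + v))) ^ p) - (- ((1 / (1 + 0)) ^ p))) / v) \<longlongrightarrow> real p) (at 0)"
    by (simp only: DERIV_def)
  moreover have "filterlim (\<lambda>n. 1 / (real n + s)) (at 0) sequentially"
    by real_asymp
  ultimately have "(\<lambda>n. (- ((1 / (1 + (0 + 1 / (real n + s)))) ^ p) - (- ((1 / (1 + 0)) ^ p))) / (1 / (real n + s)))
      \<longlonglongrightarrow> real p"
    by (rule filterlim_compose)
  moreover have "(\<lambda>n. (real n / (real n + s)) ^ (p + 1)) \<longlonglongrightarrow> 1 ^ (p + 1)"
    by (intro tendsto_power) real_asymp
  ultimately have "(\<lambda>n. (real n / (real n + s)) ^ (p + 1) *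
      ((- ((1 / (1 + (0 + 1 / (real n + s)))) ^ p) - (- ((1 / (1 + 0)) ^ p))) / (1 / (real n + s))))
      \<longlonglongrightarrow> 1 ^ (p + 1) * real p"
    by (intro tendsto_mult)
  hence "(\<lambda>n. (real n / (real n + s)) ^ (p + 1) *
      ((- ((1 / (1 + (0 + 1 / (real n + s)))) ^ p) - (- ((1 / (1 + 0)) ^ p))) / (1 / (real n + s))))
      \<longlonglongrightarrow> real p"
    by simp
  thus ?thesis
  proof (rule Lim_transform_eventually)
    have "\<forall>\<^sub>F n in sequentially. real n + s > 0" by real_asymp
    thus "\<forall>\<^sub>F n in sequentially. (real n / (real n + s)) ^ (p + 1) *
      ((- ((1 / (1 + (0 + 1 / (real n + s)))) ^ p) - (- ((1 / (1 + 0)) ^ p))) / (1 / (real n + s)))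
      = real n ^ (p + 1) * (1 / (real n + s) ^ p - 1 / (real (Suc n) + s) ^ p)"
    proof eventually_elim
      case (elim n)
      define x where "x = real n + s"
      have x: "x > 0" "real (Suc n) + s = x + 1" using elim by (auto simp: x_def)
      have "1 / (1 + (0 + 1 / x)) = x / (x + 1)" using x by (simp add: field_simps)
      thus ?case unfolding x(2) x_def[symmetric] using x(1)
        by (simp add: power_divide divide_simps)
    qed
  qed
qed

lemma tendsto_from_differences:
  fixes a :: "nat \<Rightarrow> real"
  assumes "p > 0" and a: "a \<longlonglongrightarrow> 0"
    and lim: "(\<lambda>n. real n ^ (p + 1) * (a n - a (Suc n))) \<longlonglongrightarrow> real p * L"
  shows "(\<lambda>n. real n ^ p * a n) \<longlonglongrightarrow> L"
proof -
  let ?b = "\<lambda>n. 1 / real n ^ p"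
  have "(\<lambda>n. a n / ?b n) \<longlonglongrightarrow> L"
  proof (rule stolz_cesaro_0[OF a])
    show "?b \<longlonglongrightarrow> 0" using \<open>p > 0\<close> by real_asymp
    \<comment> \<open>Strict decrease fails at n = 0, where division by zero makes
      \<open>?b 0\<close> equal to 0.\<close>
    show "\<forall>\<^sub>F n in sequentially. ?b (Suc n) < ?b n"
      using eventually_gt_at_top[of 0]
      by eventually_elim (use \<open>p > 0\<close> in \<open>auto intro!: divide_strict_left_mono power_strict_mono\<close>)
    have "(\<lambda>n. real n ^ (p + 1) * (a n - a (Suc n)) / (real n ^ (p + 1) * (?b n - ?b (Suc n))))
        \<longlonglongrightarrow> real p * L / real p"
      using inverse_power_diff_tendsto[of p 0] \<open>p > 0\<close> by (intro tendsto_divide lim) auto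
    hence "(\<lambda>n. real n ^ (p + 1) * (a n - a (Suc n)) / (real n ^ (p + 1) * (?b n - ?b (Suc n)))) \<longlonglongrightarrow> L"
      using \<open>p > 0\<close> by simp
    thus "(\<lambda>n. (a n - a (Suc n)) / (?b n - ?b (Suc n))) \<longlonglongrightarrow> L"
      by (rule Lim_transform_eventually) (auto intro!: eventually_mono[OF eventually_gt_at_top[of 0]])
  qed
  thus ?thesis by (simp add: mult.commute)
qed

section \<open>Truncated expansions and their recurrences\<close>

text \<open>
  The asymptotic expansion of $\pi w_n$ at $t = n + \frac14$, truncated. The coefficients are
  determined recursively by $(n+1)^2 w_{n+1} = (n + \frac12)^2 w_n$.
\<close>

definition term_approx :: "real \<Rightarrow> real" where
  "term_approx t =
     (t ^ 14 - 1 / 32 * t ^ 12 + 11 / 2048 * t ^ 10 - 173 / 65536 * t ^ 8 + 22931 / 8388608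
      * t ^ 6 - 1319183 / 268435456 * t ^ 4 + 233526463 / 17179869184 * t ^ 2 - 29412432709
      / 549755813888) / t ^ 15"

text \<open>
  The asymptotic expansion of $\pi (G(n) - \mathrm{MC}_0(n))$ in $1/x$, truncated. The coefficients
  are determined recursively by $G(n+1) - G(n) = w_{n+1}$.
\<close>

definition G_approx :: "real \<Rightarrow> real" where
  "G_approx x =
     (11 / 192 * x ^ 6 - 1541 / 122880 * x ^ 5 + 63433 / 8257536 * x ^ 4 - 9199901 /
      1006632960 * x ^ 3 + 317959723 / 17716740096 * x ^ 2 - 14849190321163 /
      281406257233920 * x + 717209117969 / 3298534883328) / x ^ 7"

text \<open>The first eight terms of 2 artanh(1/(2t)) = ln(t + 1/2) - ln(t - 1/2).\<close>

definition ln_diff_approx :: "real \<Rightarrow> real" where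
  "ln_diff_approx t =
     (t ^ 14 + 1 / 12 * t ^ 12 + 1 / 80 * t ^ 10 + 1 / 448 * t ^ 8 + 1 / 2304 * t ^ 6 + 1 /
      11264 * t ^ 4 + 1 / 53248 * t ^ 2 + 1 / 245760) / t ^ 15"

text \<open>With m = n + 3/4, the points m + 1/2 and m - 1/2 are (n+1) + 1/4 and n + 1/4, while m +
  1/4 = n + 1 and m - 1/4 = n + 1/2. The bracket is thus the defect of \<open>term_approx\<close> in
  the recurrence of w_n.\<close>

lemma term_approx_recurrence:
  "((\<lambda>m. m ^ 14 * ((m + 1 / 4)\<^sup>2 * term_approx (m + 1 / 2) -
       (m - 1 / 4)\<^sup>2 * term_approx (m - 1 / 2))) \<longlongrightarrow> 0) at_top"
proof -
  let ?N = "\<lambda>t::real.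
      t ^ 14 - 1 / 32 * t ^ 12 + 11 / 2048 * t ^ 10 - 173 / 65536 * t ^ 8 + 22931 / 8388608
      * t ^ 6 - 1319183 / 268435456 * t ^ 4 + 233526463 / 17179869184 * t ^ 2 - 29412432709
      / 549755813888"
  \<comment> \<open>The numerator over the common denominator. The chosen coefficients cancel all
    powers above 14, against degree 30 below, so the defect is O(m^(-16)). Only even powers occur
    because \<open>term_approx\<close> is odd.\<close>
  let ?R = "\<lambda>m::real.
      39959591850371 / 8796093022208 * m ^ 14 + 212065094780251 / 35184372088832 * m ^ 12 +
      257281209159999 / 140737488355328 * m ^ 10 + 16746664957703 / 562949953421312 * m ^ 8
      - 44848918200727 / 2251799813685248 * m ^ 6 - 729193949679 / 9007199254740992 * m ^ 4
      + 1391185886101 / 36028797018963968 * m ^ 2 + 27663020237 / 144115188075855872"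
  have eq: "(m + 1 / 4)\<^sup>2 * term_approx (m + 1 / 2) - (m - 1 / 4)\<^sup>2 * term_approx (m - 1 / 2)
      = ?R m / ((m + 1 / 2) ^ 15 * (m - 1 / 2) ^ 15)" (is "?lhs = _") if "m > 1 / 2" for m
  proof -
    have "?lhs = (m + 1 / 4)\<^sup>2 * ?N (m + 1 / 2) / (m + 1 / 2) ^ 15
        - (m - 1 / 4)\<^sup>2 * ?N (m - 1 / 2) / (m - 1 / 2) ^ 15"
      by (simp only: term_approx_def times_divide_eq_right)
    also have "\<dots> = ((m + 1 / 4)\<^sup>2 * ?N (m + 1 / 2) * (m - 1 / 2) ^ 15
        - (m - 1 / 4)\<^sup>2 * ?N (m - 1 / 2) * (m + 1 / 2) ^ 15) / ((m + 1 / 2) ^ 15 * (m - 1 / 2) ^ 15)"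
      using that by (intro diff_frac_eq) auto
    also have "(m + 1 / 4)\<^sup>2 * ?N (m + 1 / 2) * (m - 1 / 2) ^ 15
        - (m - 1 / 4)\<^sup>2 * ?N (m - 1 / 2) * (m + 1 / 2) ^ 15 = ?R m"
      by algebra
    finally show ?thesis .
  qed
  have "((\<lambda>m. m ^ 14 * (?R m / ((m + 1 / 2) ^ 15 * (m - 1 / 2) ^ 15))) \<longlongrightarrow> 0) at_top"
    by real_asymp
  thus ?thesis
    by (rule Lim_transform_eventually)
       (use eventually_gt_at_top[of "1 / 2"] in eventually_elim, simp only: eq)
qed

lemma ln_diff_expansion:
  "((\<lambda>t. t ^ 15 * (ln (t + 1 / 2) - ln (t - 1 / 2) - ln_diff_approx t)) \<longlongrightarrow> 0) at_top"
proof (rule tendsto_sandwich)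
  have bounds: "0 \<le> t ^ 15 * (ln (t + 1 / 2) - ln (t - 1 / 2) - ln_diff_approx t) \<and>
      t ^ 15 * (ln (t + 1 / 2) - ln (t - 1 / 2) - ln_diff_approx t)
        \<le> t ^ 15 * (2 * ((1 / (2 * t)) ^ 17 / (1 - (1 / (2 * t))\<^sup>2) / 17))" if "t > 1 / 2" for t
  proof -
    have pos: "t > 0" "t ^ 15 > 0" using that by auto
    have "ln ((t + 1 / 2) / (t - 1 / 2)) = ln (t + 1 / 2) - ln (t - 1 / 2)"
      using that by (simp add: ln_div)
    moreover have "((t + 1 / 2) / (t - 1 / 2) - 1) / ((t + 1 / 2) / (t - 1 / 2) + 1) = 1 / (2 * t)"
      using that by (simp add: field_simps)
    moreover have "(\<Sum>k<8. 2 * (1 / (2 * t)) ^ (2 * k + 1) / real (2 * k + 1)) = ln_diff_approx t"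
      using pos by (simp add: ln_diff_approx_def eval_nat_numeral) (simp add: field_simps)
    \<comment> \<open>The argument 8 counts the terms of the artanh series; the remainder is
      O(t^(-17)).\<close>
    ultimately have "ln (t + 1 / 2) - ln (t - 1 / 2) \<in> {ln_diff_approx t..
        ln_diff_approx t + 2 * ((1 / (2 * t)) ^ 17 / (1 - (1 / (2 * t))\<^sup>2) / 17)}"
      using ln_approx_bounds[of "(t + 1 / 2) / (t - 1 / 2)" 8] that by simp
    thus ?thesis
      using pos by (intro conjI mult_nonneg_nonneg mult_left_mono) auto
  qed
  show "\<forall>\<^sub>F t in at_top. 0 \<le> t ^ 15 * (ln (t + 1 / 2) - ln (t - 1 / 2) - ln_diff_approx t)"
    using eventually_gt_at_top[of "1 / 2 :: real"] by eventually_elim (use bounds in blast)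
  show "\<forall>\<^sub>F t in at_top. t ^ 15 * (ln (t + 1 / 2) - ln (t - 1 / 2) - ln_diff_approx t)
      \<le> t ^ 15 * (2 * ((1 / (2 * t)) ^ 17 / (1 - (1 / (2 * t))\<^sup>2) / 17))"
    using eventually_gt_at_top[of "1 / 2 :: real"] by eventually_elim (use bounds in blast)
  show "((\<lambda>t::real. t ^ 15 * (2 * ((1 / (2 * t)) ^ 17 / (1 - (1 / (2 * t))\<^sup>2) / 17))) \<longlongrightarrow> 0) at_top"
    by real_asymp
qed auto

text \<open>With t = n + 5/4, the squares of t + 1/2 and t - 1/2 are x(n+1) and x(n), and t is the
  point at which w_{n+1} is expanded. This is the defect in G(n+1) - G(n) = w_{n+1}, multiplied by
  pi.\<close>

lemma G_approx_difference:
  "((\<lambda>t. t ^ 15 * (ln (t + 1 / 2) - ln (t - 1 / 2)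
      + G_approx ((t + 1 / 2)\<^sup>2) - G_approx ((t - 1 / 2)\<^sup>2) - term_approx t)) \<longlongrightarrow> 0) at_top"
proof -
  let ?L = "\<lambda>t::real.
      t ^ 14 + 1 / 12 * t ^ 12 + 1 / 80 * t ^ 10 + 1 / 448 * t ^ 8 + 1 / 2304 * t ^ 6 + 1 /
      11264 * t ^ 4 + 1 / 53248 * t ^ 2 + 1 / 245760"
  let ?Q = "\<lambda>t::real.
      t ^ 14 - 1 / 32 * t ^ 12 + 11 / 2048 * t ^ 10 - 173 / 65536 * t ^ 8 + 22931 / 8388608
      * t ^ 6 - 1319183 / 268435456 * t ^ 4 + 233526463 / 17179869184 * t ^ 2 - 29412432709
      / 549755813888"
  let ?N = "\<lambda>s::real.
      11 / 192 * s ^ 12 - 1541 / 122880 * s ^ 10 + 63433 / 8257536 * s ^ 8 - 9199901 /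
      1006632960 * s ^ 6 + 317959723 / 17716740096 * s ^ 4 - 14849190321163 /
      281406257233920 * s ^ 2 + 717209117969 / 3298534883328"
  \<comment> \<open>The numerator after the logarithm is replaced by its truncated series. It has
    degree 26 against 43 in the denominator, so the defect is O(t^(-17)).\<close>
  let ?S = "\<lambda>t::real.
      - 77786277491443 / 4123168604160 * t ^ 26 - 6305005130802409 / 230897441832960 * t ^
      24 - 26437375539051803 / 2177033022996480 * t ^ 22 - 50187043586160353 /
      34832528367943680 * t ^ 20 - 172619187871651033 / 905645737566535680 * t ^ 18 +
      2110567025856203141 / 50716161303725998080 * t ^ 16 - 300715983554119 /
      25332747903959040 * t ^ 14 + 4151134223730251 / 1621295865853378560 * t ^ 12 -
      15052994253597767 / 35668509048774328320 * t ^ 10 + 104431996443160277 /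
      1997436506731362385920 * t ^ 8 - 1346293399149151 / 285348072390194626560 * t ^ 6 +
      5797990071188791 / 19784133019053494108160 * t ^ 4 - 40332923083997 /
      3597115094373362565120 * t ^ 2 + 441220045067 / 2213609288845146193920"
  let ?D = "\<lambda>t::real. (t + 1 / 2) ^ 14 * (t - 1 / 2) ^ 14"
  have eq: "ln_diff_approx t + G_approx ((t + 1 / 2)\<^sup>2) - G_approx ((t - 1 / 2)\<^sup>2) - term_approx t
      = ?S t / (t ^ 15 * ?D t)" (is "?lhs = _") if "t > 1 / 2" for t
  proof -
    have G: "G_approx (s\<^sup>2) = ?N s / s ^ 14" for s
      by (simp add: G_approx_def flip: power_mult)
    have "?lhs = (?L t - ?Q t) / t ^ 15
        + (?N (t + 1 / 2) / (t + 1 / 2) ^ 14 - ?N (t - 1 / 2) / (t - 1 / 2) ^ 14)"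
      unfolding G term_approx_def ln_diff_approx_def diff_divide_distrib[of "?L t" "?Q t"]
      by linarith
    also have "?N (t + 1 / 2) / (t + 1 / 2) ^ 14 - ?N (t - 1 / 2) / (t - 1 / 2) ^ 14
        = (?N (t + 1 / 2) * (t - 1 / 2) ^ 14 - ?N (t - 1 / 2) * (t + 1 / 2) ^ 14) / ?D t"
      using that by (intro diff_frac_eq) auto
    also have "(?L t - ?Q t) / t ^ 15 + \<dots> = ((?L t - ?Q t) * ?D t
        + (?N (t + 1 / 2) * (t - 1 / 2) ^ 14 - ?N (t - 1 / 2) * (t + 1 / 2) ^ 14) * t ^ 15)
            / (t ^ 15 * ?D t)"
      using that by (intro add_frac_eq) auto
    also have "(?L t - ?Q t) * ?D t
        + (?N (t + 1 / 2) * (t - 1 / 2) ^ 14 - ?N (t - 1 / 2) * (t + 1 / 2) ^ 14) * t ^ 15 = ?S t"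
      by algebra
    finally show ?thesis .
  qed
  have "((\<lambda>t. t ^ 15 * (?S t / (t ^ 15 * ?D t))) \<longlongrightarrow> 0) at_top"
    by real_asymp
  from tendsto_add[OF ln_diff_expansion this]
  have "((\<lambda>t. t ^ 15 * (ln (t + 1 / 2) - ln (t - 1 / 2) - ln_diff_approx t)
      + t ^ 15 * (?S t / (t ^ 15 * ?D t))) \<longlongrightarrow> 0) at_top"
    by (simp only: add_0_left)
  thus ?thesis
  proof (rule Lim_transform_eventually)
    show "\<forall>\<^sub>F t in at_top. t ^ 15 * (ln (t + 1 / 2) - ln (t - 1 / 2) - ln_diff_approx t)
        + t ^ 15 * (?S t / (t ^ 15 * ?D t)) =
        t ^ 15 * (ln (t + 1 / 2) - ln (t - 1 / 2)
          + G_approx ((t + 1 / 2)\<^sup>2) - G_approx ((t - 1 / 2)\<^sup>2) - term_approx t)"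
      using eventually_gt_at_top[of "1 / 2"]
    proof eventually_elim
      case (elim t)
      show ?case
        unfolding eq[OF elim, symmetric] distrib_left[symmetric]
        by (rule arg_cong[where f = "\<lambda>u. t ^ 15 * u"]) linarith
    qed
  qed
qed

lemma term_approx_asymp: "(\<lambda>n. real n * term_approx (real n + 1 / 4)) \<longlonglongrightarrow> 1"
  unfolding term_approx_def by real_asymp

section \<open>Remainders of the truncated expansions\<close>

text \<open>The recurrence is multiplicative, so the relative error a is estimated first. Its
  differences equal pi w_n B / (q_n q_{n+1} (n+1)^2), which is o(n^(-15)); hence a = o(n^(-14)), and
  multiplying by q_n, of order 1/n, gains one more power.\<close>

lemma landau_term_asymp:
  "(\<lambda>n. real n ^ 15 * (landau_term n - term_approx (real n + 1 / 4) / pi)) \<longlonglongrightarrow> 0"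
proof -
  define q where "q = (\<lambda>n::nat. term_approx (real n + 1 / 4))"
  define a where "a = (\<lambda>n. pi * landau_term n / q n - 1)"
  have nq: "(\<lambda>n. real n * q n) \<longlonglongrightarrow> 1"
    unfolding q_def by (rule term_approx_asymp)
  have q_pos: "\<forall>\<^sub>F n in sequentially. q n > 0"
  proof -
    have "\<forall>\<^sub>F n in sequentially. real n * q n > 0"
      using order_tendstoD(1)[OF nq, of 0] by simp
    thus ?thesis by eventually_elim (simp add: zero_less_mult_iff)
  qed
  have piw: "(\<lambda>n. pi * (real n * landau_term n)) \<longlonglongrightarrow> 1"
    using tendsto_mult[OF tendsto_const[of pi] mult_landau_term_tendsto] by simp
  have a_lim: "a \<longlonglongrightarrow> 0"
  proof -
    have "(\<lambda>n. pi * (real n * landau_term n) / (real n * q n) - 1) \<longlonglongrightarrow> 1 / 1 - 1"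
      by (intro tendsto_intros piw nq) auto
    hence "(\<lambda>n. pi * (real n * landau_term n) / (real n * q n) - 1) \<longlonglongrightarrow> 0" by simp
    thus ?thesis
    proof (rule Lim_transform_eventually)
      show "\<forall>\<^sub>F n in sequentially. pi * (real n * landau_term n) / (real n * q n) - 1 = a n"
        using eventually_gt_at_top[of 0] by eventually_elim (simp add: a_def)
    qed
  qed
  define B where "B = (\<lambda>m. (m + 1 / 4)\<^sup>2 * term_approx (m + 1 / 2) - (m - 1 / 4)\<^sup>2 * term_approx (m - 1 / 2))"
  have "(\<lambda>n. (real n + 3 / 4) ^ 14 * B (real n + 3 / 4)) \<longlonglongrightarrow> 0"
    unfolding B_def by (rule filterlim_compose[OF term_approx_recurrence]) real_asymp
  moreover have "(\<lambda>n. (real n / (real n + 3 / 4)) ^ 14 /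
      ((real n * q n) * (real (Suc n) * q (Suc n)) * ((real n + 1) / real n))) \<longlonglongrightarrow> 1 ^ 14 / (1 * 1 * 1)"
  proof (intro tendsto_intros nq LIMSEQ_Suc[OF nq])
    show "(\<lambda>n. real n / (real n + 3 / 4)) \<longlonglongrightarrow> 1" "(\<lambda>n. (real n + 1) / real n) \<longlonglongrightarrow> 1"
      by real_asymp+
  qed auto
  \<comment> \<open>This is n^15 (a_n - a_{n+1}) regrouped into factors with known limits; the one
    with B tends to 0.\<close>
  ultimately have "(\<lambda>n. pi * (real n * landau_term n) * ((real n / (real n + 3 / 4)) ^ 14 /
      ((real n * q n) * (real (Suc n) * q (Suc n)) * ((real n + 1) / real n))) *
      ((real n + 3 / 4) ^ 14 * B (real n + 3 / 4))) \<longlonglongrightarrow> 1 * (1 ^ 14 / (1 * 1 * 1)) * 0"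
    by (intro tendsto_mult piw)
  hence "(\<lambda>n. pi * (real n * landau_term n) * ((real n / (real n + 3 / 4)) ^ 14 /
      ((real n * q n) * (real (Suc n) * q (Suc n)) * ((real n + 1) / real n))) *
      ((real n + 3 / 4) ^ 14 * B (real n + 3 / 4))) \<longlonglongrightarrow> real 14 * 0"
    by simp
  hence "(\<lambda>n. real n ^ (14 + 1) * (a n - a (Suc n))) \<longlonglongrightarrow> real 14 * 0"
  proof (rule Lim_transform_eventually)
    have "\<forall>\<^sub>F n in sequentially. q (Suc n) > 0"
      using q_pos by (subst eventually_sequentially_Suc)
    with q_pos eventually_gt_at_top[of 0]
    show "\<forall>\<^sub>F n in sequentially. pi * (real n * landau_term n) * ((real n / (real n + 3 / 4)) ^ 14 /
        ((real n * q n) * (real (Suc n) * q (Suc n)) * ((real n + 1) / real n))) *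
        ((real n + 3 / 4) ^ 14 * B (real n + 3 / 4)) = real n ^ (14 + 1) * (a n - a (Suc n))"
    proof eventually_elim
      case (elim n)
      have B: "B (real n + 3 / 4) = (real n + 1)\<^sup>2 * q (Suc n) - (real n + 1 / 2)\<^sup>2 * q n"
        by (simp add: B_def q_def add_ac)
      have "a n - a (Suc n) = pi * landau_term n * B (real n + 3 / 4) / (q n * q (Suc n) * (real n + 1)\<^sup>2)"
        unfolding a_def B landau_term_Suc using elim
        by (simp add: divide_simps power2_eq_square) (simp add: algebra_simps)
      moreover have "pi * (real n * landau_term n) * ((real n / (real n + 3 / 4)) ^ 14 /
        ((real n * q n) * (real (Suc n) * q (Suc n)) * ((real n + 1) / real n))) *
        ((real n + 3 / 4) ^ 14 * B (real n + 3 / 4)) =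
        real n ^ (14 + 1) * (pi * landau_term n * B (real n + 3 / 4) / (q n * q (Suc n) * (real n + 1)\<^sup>2))"
      proof -
        define z y where "z = real n + 3 / 4" and "y = real n + 1"
        have "z > 0" "y > 0" "real (Suc n) = y" by (simp_all add: z_def y_def)
        thus ?thesis unfolding z_def[symmetric] y_def[symmetric] power_add using elim
          by (simp add: power_divide power2_eq_square divide_simps)
      qed
      ultimately show ?case by simp
    qed
  qed
  from tendsto_from_differences[OF _ a_lim this]
  have "(\<lambda>n. real n ^ 14 * a n) \<longlonglongrightarrow> 0" by simp
  from tendsto_mult[OF tendsto_mult[OF nq this] tendsto_const[of "1 / pi"]]
  have "(\<lambda>n. real n * q n * (real n ^ 14 * a n) * (1 / pi)) \<longlonglongrightarrow> 0" by simp
  thus ?thesis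
  proof (rule Lim_transform_eventually)
    show "\<forall>\<^sub>F n in sequentially. real n * q n * (real n ^ 14 * a n) * (1 / pi)
        = real n ^ 15 * (landau_term n - term_approx (real n + 1 / 4) / pi)"
      using q_pos
    proof eventually_elim
      case (elim n)
      have "q n * a n * (1 / pi) = landau_term n - q n / pi"
        using elim by (simp add: a_def field_simps)
      moreover have "real n * q n * (real n ^ 14 * a n) * (1 / pi) = real n ^ 15 * (q n * a n * (1 / pi))"
        by (simp add: eval_nat_numeral)
      ultimately show ?case by (simp add: q_def)
    qed
  qed
qed

definition G_remainder :: "nat \<Rightarrow> real" where
  "G_remainder n = Landau_G n - MC0 n - G_approx (xx n) / pi"

lemma G_remainder_tendsto_0: "G_remainder \<longlonglongrightarrow> 0"
proof -
  have "(\<lambda>n. G_approx (xx n)) \<longlonglongrightarrow> 0"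
    unfolding G_approx_def xx_def by real_asymp
  from tendsto_diff[OF Landau_G_minus_MC0_tendsto_0 tendsto_divide[OF this tendsto_const[of pi]]]
  show ?thesis by (simp add: G_remainder_def[abs_def])
qed

text \<open>The difference splits into the defect of \<open>G_approx\<close> at n + 5/4, divided by
  pi, minus the error of \<open>term_approx\<close> at index n + 1. The exponent 15 is 4k + 3 for k
  = 3, the largest one needed.\<close>

lemma G_remainder_diff:
  "(\<lambda>n. real n ^ 15 * (G_remainder n - G_remainder (Suc n))) \<longlonglongrightarrow> 0"
proof -
  define X where "X = (\<lambda>t::real. ln (t + 1 / 2) - ln (t - 1 / 2)
      + G_approx ((t + 1 / 2)\<^sup>2) - G_approx ((t - 1 / 2)\<^sup>2) - term_approx t)"
  define Y where "Y = (\<lambda>n. landau_term n - term_approx (real n + 1 / 4) / pi)"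
  have "(\<lambda>n. (real n + 5 / 4) ^ 15 * X (real n + 5 / 4)) \<longlonglongrightarrow> 0"
    unfolding X_def by (rule filterlim_compose[OF G_approx_difference]) real_asymp
  moreover have "(\<lambda>n. (real n / (real n + 5 / 4)) ^ 15) \<longlonglongrightarrow> 1"
    "(\<lambda>n. (real n / real (Suc n)) ^ 15) \<longlonglongrightarrow> 1"
    by real_asymp+
  moreover have "(\<lambda>n. real (Suc n) ^ 15 * Y (Suc n)) \<longlonglongrightarrow> 0"
    unfolding Y_def by (rule LIMSEQ_Suc[OF landau_term_asymp])
  ultimately have "(\<lambda>n. (real n / (real n + 5 / 4)) ^ 15 * ((real n + 5 / 4) ^ 15 * X (real n + 5 / 4)) * (1 / pi)
      - (real n / real (Suc n)) ^ 15 * (real (Suc n) ^ 15 * Y (Suc n))) \<longlonglongrightarrow> 1 * 0 * (1 / pi) - 1 * 0"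
    by (intro tendsto_diff tendsto_mult tendsto_const)
  moreover have "(real n / (real n + 5 / 4)) ^ 15 * ((real n + 5 / 4) ^ 15 * X (real n + 5 / 4)) * (1 / pi)
      - (real n / real (Suc n)) ^ 15 * (real (Suc n) ^ 15 * Y (Suc n))
      = real n ^ 15 * (G_remainder n - G_remainder (Suc n))" for n
  proof -
    have "Landau_G (Suc n) = Landau_G n + landau_term (Suc n)"
      by (simp add: Landau_G_eq_sum)
    moreover have "real n + 5 / 4 + 1 / 2 = real (Suc n) + 3 / 4" "real n + 5 / 4 - 1 / 2 = real n + 3 / 4"
      "real (Suc n) + 1 / 4 = real n + 5 / 4" by auto
    ultimately have "G_remainder n - G_remainder (Suc n) = X (real n + 5 / 4) * (1 / pi) - Y (Suc n)"
      unfolding G_remainder_def MC0_def xx_def X_def Y_def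
      by (simp only:) (simp add: field_simps)
    moreover have "(real n / (real n + 5 / 4)) ^ 15 * (real n + 5 / 4) ^ 15 = real n ^ 15"
      "(real n / real (Suc n)) ^ 15 * real (Suc n) ^ 15 = real n ^ 15"
      unfolding power_mult_distrib[symmetric] by auto
    ultimately show ?thesis
      by (simp only: mult.assoc[symmetric]) (simp only: mult.assoc right_diff_distrib)
  qed
  ultimately show ?thesis by simp
qed

section \<open>Errors of the continued fractions\<close>

lemma tendsto_0_lower_power:
  fixes f :: "nat \<Rightarrow> real"
  assumes "(\<lambda>n. real n ^ q * f n) \<longlonglongrightarrow> 0" "p \<le> q"
  shows "(\<lambda>n. real n ^ p * f n) \<longlonglongrightarrow> 0"
proof (rule Lim_null_comparison)
  show "(\<lambda>n. \<bar>real n ^ q * f n\<bar>) \<longlonglongrightarrow> 0"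
    using assms(1) by (rule tendsto_rabs_zero)
  show "\<forall>\<^sub>F n in sequentially. norm (real n ^ p * f n) \<le> \<bar>real n ^ q * f n\<bar>"
    using eventually_ge_at_top[of 1]
    by eventually_elim (use assms(2) in \<open>auto simp: abs_mult intro!: mult_right_mono power_increasing\<close>)
qed

text \<open>Since x^(2k+1) = (n + 3/4)^(4k+2), the mismatch between \<open>G_approx\<close> and M
  contributes c / (n + 3/4)^(4k+2) as main term. \<open>G_remainder\<close> is controlled through
  its differences, so the limit for differences comes first and yields the one for E.\<close>

lemma error_asymptotics:
  fixes k :: nat and c :: real
  assumes k: "k \<le> 3"
    and M: "(\<lambda>x. G_approx x - M x - pi * c / x ^ (2 * k + 1)) \<in> O(\<lambda>x. 1 / x ^ (2 * k + 2))"
    and E: "\<And>n. E n = Landau_G n - MC0 n - 1 / pi * M (xx n)"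
  shows "(\<lambda>n. real n ^ (4 * k + 3) * (E n - E (n + 1))) \<longlonglongrightarrow> real (4 * k + 2) * c \<and>
         (\<lambda>n. real n ^ (4 * k + 2) * E n) \<longlonglongrightarrow> c"
proof -
  define D where "D = (\<lambda>x. G_approx x - M x - pi * c / x ^ (2 * k + 1))"
  define r where "r = (\<lambda>n. D (xx n) / pi)"
  let ?b = "\<lambda>n. 1 / (real n + 3 / 4) ^ (4 * k + 2)"
  have exponent: "4 * k + 2 + 1 = 4 * k + 3" by simp
  have E_eq: "E n = G_remainder n + c * ?b n + r n" for n
  proof -
    have "xx n ^ (2 * k + 1) = (real n + 3 / 4) ^ (4 * k + 2)"
      unfolding xx_def power_mult[symmetric] by (simp add: algebra_simps)
    thus ?thesis unfolding E G_remainder_def r_def D_def by (simp add: diff_divide_distrib)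
  qed
  \<comment> \<open>The rest r is O(x^(-2k-2)) = O(n^(-4k-4)), already small enough without
    cancellation between r(n) and r(n+1).\<close>
  have r: "(\<lambda>n. real n ^ (4 * k + 3) * r n) \<longlonglongrightarrow> 0"
  proof -
    from M obtain C where C: "\<forall>\<^sub>F x in at_top. norm (D x) \<le> C * norm (1 / x ^ (2 * k + 2))"
      unfolding D_def[symmetric] by (elim landau_o.bigE)
    have "filterlim xx at_top sequentially" unfolding xx_def by real_asymp
    from eventually_compose_filterlim[OF C this]
    have "\<forall>\<^sub>F n in sequentially. norm (D (xx n)) \<le> C * norm (1 / xx n ^ (2 * k + 2))" .
    with eventually_gt_at_top[of 0]
    have "\<forall>\<^sub>F n in sequentially. norm (real n ^ (4 * k + 3) * r n) \<le> \<bar>C\<bar> / pi * (1 / real n)"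
    proof eventually_elim
      case (elim n)
      have "norm (D (xx n)) \<le> \<bar>C\<bar> * norm (1 / xx n ^ (2 * k + 2))"
        by (rule order_trans[OF elim(2)]) (auto intro!: divide_right_mono)
      also have "norm (1 / xx n ^ (2 * k + 2)) = 1 / (real n + 3 / 4) ^ (2 * (2 * k + 2))"
        unfolding xx_def power_mult[symmetric] by simp
      also have "2 * (2 * k + 2) = 4 * k + 4" by simp
      also have "1 / (real n + 3 / 4) ^ (4 * k + 4) \<le> 1 / real n ^ (4 * k + 4)"
        using elim(1) by (intro divide_left_mono power_mono mult_pos_pos) auto
      finally have "norm (D (xx n)) \<le> \<bar>C\<bar> * (1 / real n ^ (4 * k + 4))"
        by (simp add: mult_left_mono)
      hence "real n ^ (4 * k + 3) * norm (D (xx n)) / pi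
          \<le> real n ^ (4 * k + 3) * (\<bar>C\<bar> * (1 / real n ^ (4 * k + 4))) / pi"
        by (intro divide_right_mono mult_left_mono) auto
      also have "real n ^ (4 * k + 4) = real n ^ (4 * k + 3) * real n"
        by (simp flip: power_Suc2 add: numeral_eq_Suc)
      finally show ?case using elim(1)
        by (simp add: r_def abs_mult mult.commute)
    qed
    moreover have "(\<lambda>n. \<bar>C\<bar> / pi * (1 / real n)) \<longlonglongrightarrow> 0" by real_asymp
    ultimately show ?thesis by (rule Lim_null_comparison)
  qed
  have r_Suc: "(\<lambda>n. real n ^ (4 * k + 3) * r (Suc n)) \<longlonglongrightarrow> 0"
  proof (rule Lim_null_comparison)
    show "(\<lambda>n. \<bar>real (Suc n) ^ (4 * k + 3) * r (Suc n)\<bar>) \<longlonglongrightarrow> 0"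
      by (intro tendsto_rabs_zero LIMSEQ_Suc[OF r])
    show "\<forall>\<^sub>F n in sequentially. norm (real n ^ (4 * k + 3) * r (Suc n))
        \<le> \<bar>real (Suc n) ^ (4 * k + 3) * r (Suc n)\<bar>"
      unfolding real_norm_def abs_mult
      by (intro always_eventually allI mult_right_mono) (auto intro!: power_mono simp: power_abs)
  qed
  have "(\<lambda>n. real n ^ (4 * k + 3) * (G_remainder n - G_remainder (Suc n))) \<longlonglongrightarrow> 0"
    using k by (intro tendsto_0_lower_power[OF G_remainder_diff]) auto
  moreover have "(\<lambda>n. real n ^ (4 * k + 3) * (?b n - ?b (Suc n))) \<longlonglongrightarrow> real (4 * k + 2)"
    using inverse_power_diff_tendsto[of "4 * k + 2" "3 / 4"] by (simp only: exponent)
  ultimately have "(\<lambda>n. real n ^ (4 * k + 3) * (G_remainder n - G_remainder (Suc n))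
      + c * (real n ^ (4 * k + 3) * (?b n - ?b (Suc n)))
      + (real n ^ (4 * k + 3) * r n - real n ^ (4 * k + 3) * r (Suc n))) \<longlonglongrightarrow> 0 + c * real (4 * k + 2) + (0 - 0)"
    by (intro tendsto_add tendsto_diff tendsto_mult tendsto_const r r_Suc)
  moreover have "real n ^ (4 * k + 3) * (G_remainder n - G_remainder (Suc n))
      + c * (real n ^ (4 * k + 3) * (?b n - ?b (Suc n)))
      + (real n ^ (4 * k + 3) * r n - real n ^ (4 * k + 3) * r (Suc n))
      = real n ^ (4 * k + 3) * (E n - E (Suc n))" for n
    unfolding E_eq by (simp only: algebra_simps)
  ultimately have diff: "(\<lambda>n. real n ^ (4 * k + 3) * (E n - E (Suc n))) \<longlonglongrightarrow> real (4 * k + 2) * c"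
    by (simp only: add_0_left add_0_right diff_0_right mult.commute[of c])
  \<comment> \<open>The exponent 0 says that r itself tends to 0, as needed to make E a null
    sequence.\<close>
  have "(\<lambda>n. real n ^ 0 * r n) \<longlonglongrightarrow> 0"
    by (rule tendsto_0_lower_power[OF r]) simp
  moreover have "?b \<longlonglongrightarrow> 0" by real_asymp
  ultimately have "(\<lambda>n. G_remainder n + c * ?b n + r n) \<longlonglongrightarrow> 0 + c * 0 + 0"
    by (intro tendsto_add tendsto_mult tendsto_const G_remainder_tendsto_0) simp_all
  hence "E \<longlonglongrightarrow> 0" by (simp add: E_eq[abs_def] fun_eq_iff)
  from tendsto_from_differences[OF _ this, of "4 * k + 2" c] diff
  have "(\<lambda>n. real n ^ (4 * k + 2) * E n) \<longlonglongrightarrow> c" by (simp only: exponent)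
  with diff show ?thesis by simp
qed

text \<open>The 2k parameters of the k-th fraction match the coefficients of x^(-1) to x^(-2k); the
  first mismatch, at x^(-2k-1), is pi C_k. For k = 3 this is the last coefficient kept in
  \<open>G_approx\<close>. The pi cancels against \<open>CC\<close>, which leaves a rational
  function with rational coefficients.\<close>

lemma G_approx_minus_MC1:
  "(\<lambda>x. G_approx x - kappa1 / (x + lambda1) - pi * CC 1 / x ^ 3) \<in> O(\<lambda>x. 1 / x ^ 4)"
  unfolding G_approx_def kappa1_def lambda1_def CC_def by simp real_asymp

lemma G_approx_minus_MC2:
  "(\<lambda>x. G_approx x - kappa1 / (x + lambda1 + kappa2 / (x + lambda2)) - pi * CC 2 / x ^ 5)
     \<in> O(\<lambda>x. 1 / x ^ 6)"
  unfolding G_approx_def kappa1_def lambda1_def kappa2_def lambda2_def CC_def by simp real_asymp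

lemma G_approx_minus_MC3:
  "(\<lambda>x. G_approx x - kappa1 / (x + lambda1 + kappa2 / (x + lambda2 + kappa3 / (x + lambda3)))
     - pi * CC 3 / x ^ 7) \<in> O(\<lambda>x. 1 / x ^ 8)"
  unfolding G_approx_def kappa1_def lambda1_def kappa2_def lambda2_def kappa3_def lambda3_def CC_def
  by simp real_asymp

theorem theorem1:
  shows "\<forall>k\<in>{1, 2, 3::nat}.
    (\<lambda>n. real n ^ (4 * k + 3) * (EE k n - EE k (n + 1))) \<longlonglongrightarrow> real (4 * k + 2) * CC k \<and>
    (\<lambda>n. real n ^ (4 * k + 2) * EE k n) \<longlonglongrightarrow> CC k"
proof
  fix k :: nat assume "k \<in> {1, 2, 3}"
  then consider "k = 1" | "k = 2" | "k = 3" by auto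
  thus "(\<lambda>n. real n ^ (4 * k + 3) * (EE k n - EE k (n + 1))) \<longlonglongrightarrow> real (4 * k + 2) * CC k \<and>
    (\<lambda>n. real n ^ (4 * k + 2) * EE k n) \<longlonglongrightarrow> CC k"
  proof cases
    case 1
    show ?thesis unfolding 1
      by (rule error_asymptotics[where M = "\<lambda>x. kappa1 / (x + lambda1)"])
         (use G_approx_minus_MC1 in \<open>simp_all add: EE_def MC_def MC1_def\<close>)
  next
    case 2
    show ?thesis unfolding 2
      by (rule error_asymptotics[where M = "\<lambda>x. kappa1 / (x + lambda1 + kappa2 / (x + lambda2))"])
         (use G_approx_minus_MC2 in \<open>simp_all add: EE_def MC_def MC2_def\<close>)
  next
    case 3
    show ?thesis unfolding 3
      by (rule error_asymptotics[where
            M = "\<lambda>x. kappa1 / (x + lambda1 + kappa2 / (x + lambda2 + kappa3 / (x + lambda3)))"])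
         (use G_approx_minus_MC3 in \<open>simp_all add: EE_def MC_def MC3_def\<close>)
  qed
qed

end
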